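(* Let $G$ be a discrete group, $p\in[1,\infty)$, and let $\mathcal{X}$ be a Banach space. If an invertible isometric representation $\pi:G\to\mathcal{II}(\mathcal{X})$ admits a $p$-USF functional-vector $(f,\tau)\in\mathcal{X}^*\times\mathcal{X}$, then $$f[\mathbb{I}^*(\pi(G)')^{-1},\mathbb{I}^*(\pi(G)')]\tau\subseteq\mathscr{F}_G(\pi,\mathcal{X}),$$ where $\pi(G)'$ is the commutant of $\pi(G)$.
   Context: Banach spaces are over $\mathbb{C}$ and separable; $\mathcal{X}^*$ is the dual of $\mathcal{X}$. A discrete group is a countable group with the discrete topology (not necessarily abelian). $\mathcal{II}(\mathcal{X})$ is the set of invertible (surjective) linear isometries of $\mathcal{X}$. An invertible isometric representation of a discrete group $G$ on $\mathcal{X}$ is a group homomorphism $\pi:G\to\mathcal{II}(\mathcal{X})$, $g\mapsto\pi_g$. An unconditional Schauder frame (USF) for $\mathcal{X}$ is a pair $(\{f_g\}_{g\in G},\{\tau_g\}_{g\in G})$ with $f_g\in\mathcal{X}^*$, $\tau_g\in\mathcal{X}$ such that $x=\sum_{g\in G}f_g(x)\tau_g$ for all $x\in\mathcal{X}$, with unconditional convergence. It is a group-USF if there exist an invertible isometric representation $\pi$ of $G$ on $\mathcal{X}$, $\tau\in\mathcal{X}$ and $f\in\mathcal{X}^*$ such that $f_g=f\pi_{g^{-1}}$ and $\tau_g=\pi_g\tau$ for all $g\in G$. A group-USF is a group-$p$-USF if (i) $\theta_f:\mathcal{X}\to\ell^p(G)$, $\theta_fx=\{f_g(x)\}_{g\in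 G}$, is a well-defined isometry, and (ii) $\theta_\tau:\ell^p(G)\to\mathcal{X}$, $\theta_\tau\{a_g\}_{g\in G}=\sum_{g\in G}a_g\tau_g$, is a well-defined bounded linear operator. In this case $(f,\tau)$ is called a $p$-USF functional-vector for $\pi$. For a given $\pi$, $\mathscr{F}_G(\pi,\mathcal{X})$ is the set of all $(f_1,\tau_1)\in\mathcal{X}^*\times\mathcal{X}$ such that $(\{f_1\pi_{g^{-1}}\}_{g\in G},\{\pi_g\tau_1\}_{g\in G})$ is a group-$p$-USF for $\mathcal{X}$. For a set $\mathcal{A}$ of bounded linear operators on $\mathcal{X}$, $\mathcal{A}'$ is its commutant in the bounded linear operators on $\mathcal{X}$, $\mathbb{I}^*(\mathcal{A})$ is the set of invertible linear isometries $U:\mathcal{X}\to\mathcal{X}$ with $U\in\mathcal{A}$, and $f[\mathbb{I}^*(\mathcal{A})^{-1},\mathbb{I}^*(\mathcal{A})]\tau:=\{(fU^{-1},U\tau):U\in\mathbb{I}^*(\mathcal{A})\}$. *)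

theory Defs
  imports "HOL-Analysis.Analysis" "HOL-Algebra.Group"
begin

(* The distribution has only real Banach spaces.  A complex normed space is a real normed space
   with a complex scalar multiplication that extends the real one and for which the norm is
   homogeneous. *)

class complex_normed_vector = real_normed_vector +
  fixes scaleC :: "complex \<Rightarrow> 'a \<Rightarrow> 'a"  (infixr \<open>*\<^sub>C\<close> 75)
  assumes scaleC_add_right: "a *\<^sub>C (x + y) = a *\<^sub>C x + a *\<^sub>C y"
    and scaleC_add_left: "(a + b) *\<^sub>C x = a *\<^sub>C x + b *\<^sub>C x"
    and scaleC_scaleC: "a *\<^sub>C (b *\<^sub>C x) = (a * b) *\<^sub>C x"
    and scaleR_scaleC: "r *\<^sub>R x = complex_of_real r *\<^sub>C x"
    and norm_scaleC: "norm (a *\<^sub>C x) = cmod a * norm x"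

class complex_banach = complex_normed_vector + banach

instantiation complex :: complex_banach
begin
definition scaleC_complex :: "complex \<Rightarrow> complex \<Rightarrow> complex"
  where "scaleC_complex = (*)"
instance
  by standard (auto simp: scaleC_complex_def algebra_simps norm_mult scaleR_conv_of_real)
end

lemma vector_space_scaleC:
  "vector_space ((*\<^sub>C) :: complex \<Rightarrow> 'a \<Rightarrow> 'a::complex_normed_vector)"
proof
  show "1 *\<^sub>C x = x" for x :: 'a
    using scaleR_scaleC[of 1 x] by simp
qed (simp_all add: scaleC_add_right scaleC_add_left scaleC_scaleC)

abbreviation clinear :: "('a::complex_normed_vector \<Rightarrow> 'b::complex_normed_vector) \<Rightarrow> bool"
  where "clinear \<equiv> Vector_Spaces.linear (*\<^sub>C) (*\<^sub>C)"

definition bounded_clinear ::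
    "('a::complex_normed_vector \<Rightarrow> 'b::complex_normed_vector) \<Rightarrow> bool"
  where "bounded_clinear T \<longleftrightarrow> clinear T \<and> (\<exists>K. \<forall>x. norm (T x) \<le> K * norm x)"

definition dual_space :: "('a::complex_normed_vector \<Rightarrow> complex) set"
  where "dual_space = {f. bounded_clinear f}"

definition invertible_isometries :: "('a::complex_normed_vector \<Rightarrow> 'a) set"
  where "invertible_isometries = {U. clinear U \<and> (\<forall>x. norm (U x) = norm x) \<and> surj U}"

definition isometry_group :: "('a::complex_normed_vector \<Rightarrow> 'a) monoid"
  where "isometry_group = \<lparr>carrier = invertible_isometries, monoid.mult = (\<circ>), one = id\<rparr>"

lemma invertible_isometries_bij:
  assumes "U \<in> invertible_isometries"
  shows "bij U"
proof -
  interpret U: Vector_Spaces.linear "(*\<^sub>C)" "(*\<^sub>C)" U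
    using assms by (simp add: invertible_isometries_def)
  have "inj U"
  proof (rule injI)
    fix x y assume "U x = U y"
    then have "norm (U (x - y)) = 0" by (simp add: U.diff)
    moreover have "norm (U (x - y)) = norm (x - y)"
      using assms by (simp add: invertible_isometries_def)
    ultimately show "x = y" by simp
  qed
  then show ?thesis using assms by (simp add: invertible_isometries_def bij_def)
qed

lemma invertible_isometries_inv:
  assumes "U \<in> invertible_isometries"
  shows "inv_into UNIV U \<in> invertible_isometries"
proof -
  interpret U: Vector_Spaces.linear "(*\<^sub>C)" "(*\<^sub>C)" U
    using assms by (simp add: invertible_isometries_def)
  have bij: "bij U" and nrm: "norm (U x) = norm x" for x
    using assms invertible_isometries_bij by (auto simp: invertible_isometries_def)
  have right: "U (inv_into UNIV U x) = x" for x
    using bij by (simp add: bij_def surj_f_inv_f)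
  have eqI: "x = y" if "U x = U y" for x y
    using that bij by (meson bij_def injD)
  have "inv_into UNIV U (x + y) = inv_into UNIV U x + inv_into UNIV U y" for x y
    by (rule eqI) (simp add: right U.add)
  moreover have "inv_into UNIV U (c *\<^sub>C x) = c *\<^sub>C inv_into UNIV U x" for c x
    by (rule eqI) (simp add: right U.scale)
  ultimately have "clinear (inv_into UNIV U)"
    by (simp add: Vector_Spaces.linear_iff vector_space_scaleC)
  moreover have "norm (inv_into UNIV U x) = norm x" for x
    using nrm[of "inv_into UNIV U x"] by (simp add: right)
  ultimately show ?thesis
    using bij by (simp add: invertible_isometries_def bij_def inj_imp_surj_inv)
qed

lemma group_isometry_group: "group isometry_group"
proof (rule groupI)
  show "U \<otimes>\<^bsub>isometry_group\<^esub> V \<in> carrier isometry_group"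
    if "U \<in> carrier isometry_group" "V \<in> carrier isometry_group" for U V :: "'a \<Rightarrow> 'a"
    using that comp_surj[of V U]
    by (auto simp: isometry_group_def invertible_isometries_def Vector_Spaces.linear_iff)
  show "\<exists>V\<in>carrier isometry_group. V \<otimes>\<^bsub>isometry_group\<^esub> U = \<one>\<^bsub>isometry_group\<^esub>"
    if "U \<in> carrier isometry_group" for U :: "'a \<Rightarrow> 'a"
    using that invertible_isometries_inv[of U] invertible_isometries_bij[of U]
    by (auto simp: isometry_group_def bij_def intro!: bexI[of _ "inv_into UNIV U"])
qed (auto simp: isometry_group_def invertible_isometries_def Vector_Spaces.linear_iff
      vector_space_scaleC)

definition invertible_isometric_rep ::
    "('g, 'm) monoid_scheme \<Rightarrow> ('g \<Rightarrow> 'a::complex_normed_vector \<Rightarrow> 'a) \<Rightarrow> bool"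
  where "invertible_isometric_rep G \<pi> \<longleftrightarrow> \<pi> \<in> hom G isometry_group"

(* Elements of l^p(I), for an arbitrary index set I, are represented by the functions on the
   ambient type that vanish outside I. *)

definition lp_space :: "real \<Rightarrow> 'i set \<Rightarrow> ('i \<Rightarrow> complex) set"
  where "lp_space p I =
    {a. (\<forall>i. i \<notin> I \<longrightarrow> a i = 0) \<and> (\<lambda>i. cmod (a i) powr p) summable_on I}"

definition lp_norm :: "real \<Rightarrow> 'i set \<Rightarrow> ('i \<Rightarrow> complex) \<Rightarrow> real"
  where "lp_norm p I a = (\<Sum>\<^sub>\<infinity>i\<in>I. cmod (a i) powr p) powr (1 / p)"

(* Families indexed by G are functions of which only the values on carrier G matter. *)

definition analysis_op ::
    "('g, 'm) monoid_scheme \<Rightarrow> ('g \<Rightarrow> 'a \<Rightarrow> complex) \<Rightarrow> 'a \<Rightarrow> 'g \<Rightarrow> complex"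
  where "analysis_op G F x = (\<lambda>g. if g \<in> carrier G then F g x else 0)"

definition synthesis_op ::
    "('g, 'm) monoid_scheme \<Rightarrow> ('g \<Rightarrow> 'a::complex_normed_vector) \<Rightarrow> ('g \<Rightarrow> complex) \<Rightarrow> 'a"
  where "synthesis_op G T a = (\<Sum>\<^sub>\<infinity>g\<in>carrier G. a g *\<^sub>C T g)"

definition lp_isometry ::
    "real \<Rightarrow> 'i set \<Rightarrow> ('a::complex_normed_vector \<Rightarrow> 'i \<Rightarrow> complex) \<Rightarrow> bool"
  where "lp_isometry p I \<theta> \<longleftrightarrow>
    (\<forall>x. \<theta> x \<in> lp_space p I) \<and>
    (\<forall>x y. \<theta> (x + y) = (\<lambda>i. \<theta> x i + \<theta> y i)) \<and>
    (\<forall>c x. \<theta> (c *\<^sub>C x) = (\<lambda>i. c * \<theta> x i)) \<and>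
    (\<forall>x. lp_norm p I (\<theta> x) = norm x)"

definition lp_bounded_clinear ::
    "real \<Rightarrow> 'i set \<Rightarrow> (('i \<Rightarrow> complex) \<Rightarrow> 'a::complex_normed_vector) \<Rightarrow> bool"
  where "lp_bounded_clinear p I \<theta> \<longleftrightarrow>
    (\<forall>a\<in>lp_space p I. \<forall>b\<in>lp_space p I. \<theta> (\<lambda>i. a i + b i) = \<theta> a + \<theta> b) \<and>
    (\<forall>c. \<forall>a\<in>lp_space p I. \<theta> (\<lambda>i. c * a i) = c *\<^sub>C \<theta> a) \<and>
    (\<exists>K. \<forall>a\<in>lp_space p I. norm (\<theta> a) \<le> K * lp_norm p I a)"

(* has_sum and summable_on are convergence of the net of finite partial sums, which in a Banach
   space is unconditional convergence. *)

definition unconditional_schauder_frame ::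
    "('g, 'm) monoid_scheme \<Rightarrow> ('g \<Rightarrow> 'a::complex_banach \<Rightarrow> complex) \<Rightarrow> ('g \<Rightarrow> 'a) \<Rightarrow> bool"
  where "unconditional_schauder_frame G F T \<longleftrightarrow>
    (\<forall>g\<in>carrier G. F g \<in> dual_space) \<and>
    (\<forall>x. ((\<lambda>g. F g x *\<^sub>C T g) has_sum x) (carrier G))"

definition group_usf ::
    "('g, 'm) monoid_scheme \<Rightarrow> ('g \<Rightarrow> 'a::complex_banach \<Rightarrow> complex) \<Rightarrow> ('g \<Rightarrow> 'a) \<Rightarrow> bool"
  where "group_usf G F T \<longleftrightarrow>
    unconditional_schauder_frame G F T \<and>
    (\<exists>\<pi> f \<tau>. invertible_isometric_rep G \<pi> \<and> f \<in> dual_space \<and>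
      (\<forall>g\<in>carrier G. F g = f \<circ> \<pi> (inv\<^bsub>G\<^esub> g) \<and> T g = \<pi> g \<tau>))"

definition group_p_usf ::
    "('g, 'm) monoid_scheme \<Rightarrow> real \<Rightarrow>
      ('g \<Rightarrow> 'a::complex_banach \<Rightarrow> complex) \<Rightarrow> ('g \<Rightarrow> 'a) \<Rightarrow> bool"
  where "group_p_usf G p F T \<longleftrightarrow>
    group_usf G F T \<and>
    lp_isometry p (carrier G) (analysis_op G F) \<and>
    (\<forall>a\<in>lp_space p (carrier G). (\<lambda>g. a g *\<^sub>C T g) summable_on carrier G) \<and>
    lp_bounded_clinear p (carrier G) (synthesis_op G T)"

definition p_usf_functional_vectors ::
    "('g, 'm) monoid_scheme \<Rightarrow> real \<Rightarrow> ('g \<Rightarrow> 'a::complex_banach \<Rightarrow> 'a) \<Rightarrow>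
      (('a \<Rightarrow> complex) \<times> 'a) set"
  where "p_usf_functional_vectors G p \<pi> =
    {(f, \<tau>). f \<in> dual_space \<and>
      group_p_usf G p (\<lambda>g. f \<circ> \<pi> (inv\<^bsub>G\<^esub> g)) (\<lambda>g. \<pi> g \<tau>)}"

definition commutant :: "('a::complex_normed_vector \<Rightarrow> 'a) set \<Rightarrow> ('a \<Rightarrow> 'a) set"
  where "commutant A = {T. bounded_clinear T \<and> (\<forall>S\<in>A. T \<circ> S = S \<circ> T)}"

definition isometries_in :: "('a::complex_normed_vector \<Rightarrow> 'a) set \<Rightarrow> ('a \<Rightarrow> 'a) set"
  where "isometries_in A = {U \<in> A. U \<in> invertible_isometries}"

definition functional_vector_orbit ::
    "('a::complex_normed_vector \<Rightarrow> complex) \<Rightarrow> ('a \<Rightarrow> 'a) set \<Rightarrow> 'a \<Rightarrow>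
      (('a \<Rightarrow> complex) \<times> 'a) set"
  where "functional_vector_orbit f \<U> \<tau> = {(f \<circ> inv_into UNIV U, U \<tau>) | U. U \<in> \<U>}"

end

theory Submission
  imports Defs
begin

text \<open>
  Let \<open>U\<close> be an invertible isometry commuting with every \<open>\<pi> g\<close>.  Then its inverse \<open>V\<close> commutes
  with every \<open>\<pi> g\<close> too, and so
  \<open>(f \<circ> V) \<circ> \<pi> (inv g) = (f \<circ> \<pi> (inv g)) \<circ> V\<close> and \<open>\<pi> g (U \<tau>) = U (\<pi> g \<tau>)\<close>.
  The frame generated by \<open>(f \<circ> V, U \<tau>)\<close> is therefore the original frame transported along \<open>U\<close>:
  its analysis operator is the original one after \<open>V\<close>, its synthesis operator is \<open>U\<close> after the
  original one, and its expansion of \<open>x\<close> is the image under \<open>U\<close> of the original expansion of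
  \<open>V x\<close>.  Since \<open>U\<close> and \<open>V\<close> are linear and norm preserving, all analytic properties of a
  group-\<open>p\<close>-USF carry over to the transported frame (\<open>group_p_usf_transport\<close>).  An
  arbitrary \<open>U\<close> would yield a frame generated by the conjugates \<open>U \<circ> \<pi> g \<circ> V\<close>; the commutation
  makes these equal to \<open>\<pi> g\<close>.
\<close>

lemma invertible_isometries_bounded_linear:
  assumes "U \<in> invertible_isometries"
  shows "bounded_linear U"
proof -
  interpret U: Vector_Spaces.linear "(*\<^sub>C)" "(*\<^sub>C)" U
    using assms by (simp add: invertible_isometries_def)
  show ?thesis
    using assms
    by (intro bounded_linear_intro[where K = 1])
      (simp_all add: U.add U.scale scaleR_scaleC invertible_isometries_def)
qed

lemma dual_space_comp_isometry:
  assumes "f \<in> dual_space" and "V \<in> invertible_isometries"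
  shows "f \<circ> V \<in> dual_space"
proof -
  obtain K where "norm (f x) \<le> K * norm x" for x
    using assms(1) by (auto simp: dual_space_def bounded_clinear_def)
  then have "norm (f (V x)) \<le> K * norm x" for x
    using assms(2) by (metis (mono_tags, lifting) invertible_isometries_def mem_Collect_eq)
  then show ?thesis
    using assms
    by (auto simp: dual_space_def bounded_clinear_def invertible_isometries_def
        Vector_Spaces.linear_iff)
qed

text \<open>Applying \<open>U\<close> to the expansion of \<open>inv_into UNIV U x\<close> term by term, which its continuity
  permits, gives an expansion of \<open>x\<close>.\<close>

lemma unconditional_schauder_frame_transport:
  assumes usf: "unconditional_schauder_frame G F T"
    and U: "U \<in> invertible_isometries"
    and F': "\<And>g. g \<in> carrier G \<Longrightarrow> F' g = F g \<circ> inv_into UNIV U"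
    and T': "\<And>g. g \<in> carrier G \<Longrightarrow> T' g = U (T g)"
  shows "unconditional_schauder_frame G F' T'"
  unfolding unconditional_schauder_frame_def
proof (intro conjI ballI allI)
  interpret U: Vector_Spaces.linear "(*\<^sub>C)" "(*\<^sub>C)" U
    using U by (simp add: invertible_isometries_def)
  let ?V = "inv_into UNIV U"
  show "F' g \<in> dual_space" if "g \<in> carrier G" for g
    using that usf dual_space_comp_isometry[OF _ invertible_isometries_inv[OF U]]
    by (simp add: F' unconditional_schauder_frame_def)
  fix x
  have "((\<lambda>g. F g (?V x) *\<^sub>C T g) has_sum ?V x) (carrier G)"
    using usf by (simp add: unconditional_schauder_frame_def)
  from has_sum_bounded_linear[OF invertible_isometries_bounded_linear[OF U] this]
  have "((\<lambda>g. F g (?V x) *\<^sub>C U (T g)) has_sum U (?V x)) (carrier G)"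
    by (simp add: U.scale)
  moreover have "U (?V x) = x"
    using U by (simp add: invertible_isometries_def surj_f_inv_f)
  ultimately have "((\<lambda>g. F g (?V x) *\<^sub>C U (T g)) has_sum x) (carrier G)"
    by metis
  then show "((\<lambda>g. F' g x *\<^sub>C T' g) has_sum x) (carrier G)"
    by (simp add: F' T' cong: has_sum_cong)
qed

lemma lp_isometry_comp_isometry:
  assumes "lp_isometry p I \<theta>" and "V \<in> invertible_isometries"
  shows "lp_isometry p I (\<theta> \<circ> V)"
  using assms
  by (simp add: lp_isometry_def invertible_isometries_def Vector_Spaces.linear_iff)

lemma isometry_comp_lp_bounded_clinear:
  assumes "lp_bounded_clinear p I \<theta>" and "U \<in> invertible_isometries"
  shows "lp_bounded_clinear p I (U \<circ> \<theta>)"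
  using assms
  by (simp add: lp_bounded_clinear_def invertible_isometries_def Vector_Spaces.linear_iff)

lemma analysis_op_transport:
  assumes "\<And>g. g \<in> carrier G \<Longrightarrow> F' g = F g \<circ> V"
  shows "analysis_op G F' = analysis_op G F \<circ> V"
  using assms by (simp add: analysis_op_def fun_eq_iff)

text \<open>No convergence hypothesis is made on \<open>a\<close>: since \<open>U\<close> and its inverse are both continuous, a
  family is summable exactly when its image under \<open>U\<close> is, and both sums are \<open>0\<close> by convention
  otherwise.\<close>

lemma synthesis_op_transport:
  assumes U: "U \<in> invertible_isometries"
    and T': "\<And>g. g \<in> carrier G \<Longrightarrow> T' g = U (T g)"
  shows "synthesis_op G T' = U \<circ> synthesis_op G T"
proof
  interpret U: Vector_Spaces.linear "(*\<^sub>C)" "(*\<^sub>C)" U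
    using U by (simp add: invertible_isometries_def)
  fix a
  have "synthesis_op G T' a = (\<Sum>\<^sub>\<infinity>g\<in>carrier G. U (a g *\<^sub>C T g))"
    unfolding synthesis_op_def by (rule infsum_cong) (simp add: T' U.scale)
  also have "\<dots> = U (synthesis_op G T a)"
    unfolding synthesis_op_def
    using invertible_isometries_bij[OF U]
    by (intro infsum_bounded_linear_strong
        summable_on_bounded_linear_iff[where h' = "inv_into UNIV U"]
        invertible_isometries_bounded_linear invertible_isometries_inv U)
      (simp add: bij_is_inj)
  finally show "synthesis_op G T' a = (U \<circ> synthesis_op G T) a"
    by simp
qed

text \<open>The transported frame is always generated by the conjugated representation
  \<open>\<lambda>g. U \<circ> \<pi> g \<circ> inv_into UNIV U\<close>; here any generating triple may be supplied instead, because for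
  \<open>U\<close> in the commutant the given \<open>\<pi>\<close> itself serves.  The relations are required on \<open>carrier G\<close> only,
  since outside it \<open>inv\<^bsub>G\<^esub> g\<close> and \<open>\<pi> g\<close> are arbitrary and need not commute with \<open>U\<close>.\<close>

lemma group_p_usf_transport:
  assumes p_usf: "group_p_usf G p F T"
    and U: "U \<in> invertible_isometries"
    and F': "\<And>g. g \<in> carrier G \<Longrightarrow> F' g = F g \<circ> inv_into UNIV U"
    and T': "\<And>g. g \<in> carrier G \<Longrightarrow> T' g = U (T g)"
    and rep: "invertible_isometric_rep G \<pi>" "f \<in> dual_space"
      "\<And>g. g \<in> carrier G \<Longrightarrow> F' g = f \<circ> \<pi> (inv\<^bsub>G\<^esub> g)"
      "\<And>g. g \<in> carrier G \<Longrightarrow> T' g = \<pi> g \<tau>"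
  shows "group_p_usf G p F' T'"
  unfolding group_p_usf_def
proof (intro conjI ballI)
  interpret U: Vector_Spaces.linear "(*\<^sub>C)" "(*\<^sub>C)" U
    using U by (simp add: invertible_isometries_def)
  have "unconditional_schauder_frame G F' T'"
    by (rule unconditional_schauder_frame_transport[OF _ U F' T'])
      (use p_usf in \<open>simp add: group_p_usf_def group_usf_def\<close>)
  then show "group_usf G F' T'"
    using rep unfolding group_usf_def by blast
  have "analysis_op G F' = analysis_op G F \<circ> inv_into UNIV U"
    by (rule analysis_op_transport) (rule F')
  then show "lp_isometry p (carrier G) (analysis_op G F')"
    using p_usf lp_isometry_comp_isometry[OF _ invertible_isometries_inv[OF U]]
    unfolding group_p_usf_def by metis
  have "synthesis_op G T' = U \<circ> synthesis_op G T"
    by (rule synthesis_op_transport[OF U T'])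
  then show "lp_bounded_clinear p (carrier G) (synthesis_op G T')"
    using p_usf isometry_comp_lp_bounded_clinear[OF _ U] unfolding group_p_usf_def by metis
  fix a assume "a \<in> lp_space p (carrier G)"
  then have "(\<lambda>g. a g *\<^sub>C T g) summable_on carrier G"
    using p_usf by (simp add: group_p_usf_def)
  from summable_on_bounded_linear[OF invertible_isometries_bounded_linear[OF U] this]
  show "(\<lambda>g. a g *\<^sub>C T' g) summable_on carrier G"
    by (simp add: T' U.scale cong: summable_on_cong)
qed

lemma inv_comp_commute:
  assumes "bij U" and "U \<circ> S = S \<circ> U"
  shows "inv_into UNIV U \<circ> S = S \<circ> inv_into UNIV U"
proof
  fix x
  have "U (S (inv_into UNIV U x)) = S x"
    using assms by (metis bij_inv_eq_iff comp_apply)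
  then show "(inv_into UNIV U \<circ> S) x = (S \<circ> inv_into UNIV U) x"
    using assms(1) by (metis bij_inv_eq_iff comp_apply)
qed

theorem proposition2p14:
  fixes G :: "('g, 'm) monoid_scheme"
    and p :: real
    and \<pi> :: "'g \<Rightarrow> 'x::complex_banach \<Rightarrow> 'x"
    and f :: "'x \<Rightarrow> complex"
    and \<tau> :: 'x
  assumes "group G" and "countable (carrier G)"
    and "1 \<le> p"
    and "separable_space (euclidean :: 'x topology)"
    and "invertible_isometric_rep G \<pi>"
    and "(f, \<tau>) \<in> p_usf_functional_vectors G p \<pi>"
  shows "functional_vector_orbit f (isometries_in (commutant (\<pi> ` carrier G))) \<tau>
    \<subseteq> p_usf_functional_vectors G p \<pi>"
proof
  fix z
  assume "z \<in> functional_vector_orbit f (isometries_in (commutant (\<pi> ` carrier G))) \<tau>"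
  then obtain U where z: "z = (f \<circ> inv_into UNIV U, U \<tau>)"
    and U: "U \<in> invertible_isometries"
    and comm: "\<And>g. g \<in> carrier G \<Longrightarrow> U \<circ> \<pi> g = \<pi> g \<circ> U"
    by (auto simp: functional_vector_orbit_def isometries_in_def commutant_def)
  let ?V = "inv_into UNIV U"
  have f: "f \<in> dual_space"
    and p_usf: "group_p_usf G p (\<lambda>g. f \<circ> \<pi> (inv\<^bsub>G\<^esub> g)) (\<lambda>g. \<pi> g \<tau>)"
    using assms(6) by (simp_all add: p_usf_functional_vectors_def)
  have fV: "f \<circ> ?V \<in> dual_space"
    by (rule dual_space_comp_isometry[OF f invertible_isometries_inv[OF U]])
  have F': "(f \<circ> ?V) \<circ> \<pi> (inv\<^bsub>G\<^esub> g) = (f \<circ> \<pi> (inv\<^bsub>G\<^esub> g)) \<circ> ?V" if "g \<in> carrier G" for g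
    using inv_comp_commute[OF invertible_isometries_bij[OF U] comm]
      group.inv_closed[OF assms(1) that]
    by (simp add: comp_assoc)
  have T': "\<pi> g (U \<tau>) = U (\<pi> g \<tau>)" if "g \<in> carrier G" for g
    using comm[OF that] by (metis comp_apply)
  have "group_p_usf G p (\<lambda>g. (f \<circ> ?V) \<circ> \<pi> (inv\<^bsub>G\<^esub> g)) (\<lambda>g. \<pi> g (U \<tau>))"
    by (rule group_p_usf_transport[OF p_usf U F' T' assms(5) fV]) simp_all
  then show "z \<in> p_usf_functional_vectors G p \<pi>"
    using fV by (simp add: z p_usf_functional_vectors_def)
qed

end
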